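(* Let $0<\beta\le 1$. The generating function of the implicit fractional linear multistep method $$\sum_{k=0}^{\infty} g_k^{(\beta)}\left[\left(1+\frac{\beta}{2}\right)y_{n-k}-\frac{\beta}{2}\,y_{n-k-1}\right]=h^\beta f_n,\qquad n=1,2,\dots,$$ is given by $$\delta(\xi)=(1-\xi)^\beta p(\xi),\qquad p(\xi)=\left(1+\frac{\beta}{2}\right)-\frac{\beta}{2}\,\xi .$$ Moreover, the generating function satisfies $$\frac{1}{x^\beta}\,\delta(e^{-x})=1+O(x^2)\qquad\text{as } x\to 0^+ .$$
   Context: The Grünwald weights are $g_0^{(\beta)}=1$, $g_k^{(\beta)}=\left(1-\frac{\beta+1}{k}\right)g_{k-1}^{(\beta)}$ for $k\ge 1$; equivalently, $(1-z)^\beta=\sum_{k\ge 0}g_k^{(\beta)}z^k$ (principal branch). In the method, $h>0$ is the step size, $t_n=nh$, $y_n$ approximates $y(t_n)$, $f_n=f(t_n,y_n)$, and $y_j=0$ for $j<0$. Generating function: if the left-hand side of a method is rewritten in the form $\sum_{k=0}^\infty w_k y_{n-k}$ with weights $w_k$ independent of $n$ and of the sequence $(y_n)$, so that the method reads $\sum_{k=0}^{\infty} w_k y_{n-k}=h^\beta f_n$, then its generating function is the power series $\delta(\xi)=\sum_{k=0}^\infty w_k\xi^k$. The condition $x^{-\beta}\delta(e^{-x})=1+O(x^2)$ expresses consistency of order $2$ of the method. *)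

theory Defs
  imports "HOL-Analysis.Analysis" "HOL-Library.Landau_Symbols"
begin

primrec grunwald :: "real \<Rightarrow> nat \<Rightarrow> real" where
  "grunwald \<beta> 0 = 1"
| "grunwald \<beta> (Suc k) = (1 - (\<beta> + 1) / real (Suc k)) * grunwald \<beta> k"

(* Approximations are indexed by int, so that the convention y_j = 0 for j < 0 can be
   stated. Under it every series below that involves y has finitely many nonzero terms. *)

definition zero_history :: "(int \<Rightarrow> real) \<Rightarrow> bool" where
  "zero_history y \<longleftrightarrow> (\<forall>j<0. y j = 0)"

type_synonym method_lhs = "(int \<Rightarrow> real) \<Rightarrow> nat \<Rightarrow> real"

definition solves_method ::
  "method_lhs \<Rightarrow> real \<Rightarrow> real \<Rightarrow> (real \<Rightarrow> real \<Rightarrow> real) \<Rightarrow> (int \<Rightarrow> real) \<Rightarrow> bool" where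
  "solves_method L \<beta> h f y \<longleftrightarrow>
     (\<forall>n\<ge>1. L y n = h powr \<beta> * f (real n * h) (y (int n)))"

definition flmm_lhs :: "real \<Rightarrow> method_lhs" where
  "flmm_lhs \<beta> y n =
     (\<Sum>k. grunwald \<beta> k *
        ((1 + \<beta> / 2) * y (int n - int k) - \<beta> / 2 * y (int n - int k - 1)))"

definition weight_lhs :: "(nat \<Rightarrow> real) \<Rightarrow> method_lhs" where
  "weight_lhs w y n = (\<Sum>k. w k * y (int n - int k))"

(* The weights w depend neither on n nor on the sequence y. *)

definition has_weights :: "method_lhs \<Rightarrow> (nat \<Rightarrow> real) \<Rightarrow> bool" where
  "has_weights L w \<longleftrightarrow>
     (\<forall>y. zero_history y \<longrightarrow> (\<forall>n\<ge>1. L y n = weight_lhs w y n))"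

(* Meaningful only when such weights exist; they are then unique, as one sees by testing
   against sequences y supported at a single index. *)

definition weights :: "method_lhs \<Rightarrow> nat \<Rightarrow> real" where
  "weights L = (THE w. has_weights L w)"

(* Polymorphic, so that the same power series can be evaluated at real and at complex points. *)

definition generating_function ::
  "method_lhs \<Rightarrow> 'a::{banach,real_normed_algebra_1} \<Rightarrow> 'a" where
  "generating_function L \<xi> = (\<Sum>k. of_real (weights L k) * \<xi> ^ k)"

end

theory Submission
  imports Defs "HOL-Real_Asymp.Real_Asymp"
begin

text \<open>
  The weights are the Cauchy product of the Gruenwald weights with the coefficients of
  \<open>p\<close>, and the binomial series turns this into the closed form. At \<open>\<xi> = exp (-x)\<close> the factor
  \<open>((1 - exp (-x)) / x)\<^sup>\<beta>\<close> is \<open>1 - \<beta>x/2 + O(x\<^sup>2)\<close> while \<open>p(exp (-x))\<close> is \<open>1 + \<beta>x/2 + O(x\<^sup>2)\<close>,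
  so the first-order terms cancel.
\<close>

text \<open>The factor \<open>1 - (\<beta> + 1) / (k + 1)\<close> in the recurrence equals
  \<open>- (\<beta> - k) / (k + 1)\<close>, the ratio of consecutive signed binomial coefficients.
  Keeping the field generic serves both the real and the complex series.\<close>

lemma of_real_grunwald:
  "(of_real (grunwald \<beta> k) :: 'a::{field_char_0,real_div_algebra})
     = (-1) ^ k * (of_real \<beta> gchoose k)"
proof (induction k)
  case (Suc k)
  have nz: "(1 + of_nat k :: 'a) \<noteq> 0"
    by (metis of_nat_Suc of_nat_neq_0)
  have step: "(of_real \<beta> gchoose Suc k :: 'a)
      = (of_real \<beta> gchoose k) * (of_real \<beta> - of_nat k) / (1 + of_nat k)"
    using gbinomial_mult_1'[of "of_real \<beta> :: 'a" k] nz by (simp add: field_simps)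
  have ratio: "(1 - (of_real \<beta> + 1) / (1 + of_nat k) :: 'a)
      = - ((of_real \<beta> - of_nat k) / (1 + of_nat k))"
    using nz by (simp add: field_simps)
  show ?case
    by (simp add: Suc step ratio mult_ac)
qed simp

lemma grunwald_sums_complex:
  fixes z :: complex
  assumes "norm z < 1"
  shows "(\<lambda>k. of_real (grunwald \<beta> k) * z ^ k) sums (1 - z) powr of_real \<beta>"
proof -
  \<comment> \<open>The binomial series is used at \<open>- z\<close>, whose powers supply the sign
    \<open>(-1) ^ k\<close>.\<close>
  have "(of_real \<beta> gchoose k) * (- z) ^ k = of_real (grunwald \<beta> k) * z ^ k" for k
    unfolding of_real_grunwald power_minus[of z] by (simp add: mult_ac)
  then show ?thesis
    using gen_binomial_complex[of "- z" "of_real \<beta>"] assms by simp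
qed

lemma grunwald_sums_real:
  fixes z :: real
  assumes "\<bar>z\<bar> < 1"
  shows "(\<lambda>k. grunwald \<beta> k * z ^ k) sums (1 - z) powr \<beta>"
proof -
  have "(\<beta> gchoose k) * (- z) ^ k = grunwald \<beta> k * z ^ k" for k
    using of_real_grunwald[of \<beta> k, where 'a = real] power_minus[of z k] by simp
  then show ?thesis
    using gen_binomial_real[of "- z" \<beta>] assms by simp
qed

text \<open>Coefficients of \<open>(1 - z)\<close> to the power \<open>\<beta>\<close> times
  \<open>p(z)\<close>; the case split encodes a Gruenwald weight of 0 at index -1.\<close>

definition flmm_weight :: "real \<Rightarrow> nat \<Rightarrow> real" where
  "flmm_weight \<beta> k = (1 + \<beta> / 2) * grunwald \<beta> k
     - \<beta> / 2 * (case k of 0 \<Rightarrow> 0 | Suc j \<Rightarrow> grunwald \<beta> j)"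

lemma weight_lhs_finite:
  assumes "zero_history y"
  shows "weight_lhs w y n = (\<Sum>k\<le>n. w k * y (int n - int k))"
  unfolding weight_lhs_def using assms
  by (intro suminf_finite) (auto simp: zero_history_def)

lemma has_weights_flmm_weight: "has_weights (flmm_lhs \<beta>) (flmm_weight \<beta>)"
  unfolding has_weights_def
proof (intro allI impI)
  fix y and n :: nat
  assume y: "zero_history y"
  define a where "a k = grunwald \<beta> k * y (int n - int k - 1)" for k
  have shift: "(\<Sum>k\<le>n. a k)
      = (\<Sum>k\<le>n. (case k of 0 \<Rightarrow> 0 | Suc j \<Rightarrow> grunwald \<beta> j) * y (int n - int k))"
  proof -
    \<comment> \<open>The last term involves \<open>y\<close> at index -1. Dropping it lets the
      delayed sum be reindexed by one without leaving the range up to \<open>n\<close>.\<close>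
    have "a n = 0"
      using y by (simp add: a_def zero_history_def)
    then have "(\<Sum>k\<le>n. a k) = (\<Sum>k<n. a k)"
      by (simp flip: lessThan_Suc_atMost)
    then show ?thesis
      by (simp add: sum.atMost_shift a_def algebra_simps)
  qed
  have "flmm_lhs \<beta> y n = (\<Sum>k\<le>n. grunwald \<beta> k *
      ((1 + \<beta> / 2) * y (int n - int k) - \<beta> / 2 * y (int n - int k - 1)))"
    unfolding flmm_lhs_def using y
    by (intro suminf_finite) (auto simp: zero_history_def)
  also have "\<dots> = (1 + \<beta> / 2) * (\<Sum>k\<le>n. grunwald \<beta> k * y (int n - int k))
      - \<beta> / 2 * (\<Sum>k\<le>n. a k)"
    by (simp add: a_def sum_distrib_left sum_subtractf[symmetric] algebra_simps)
  also have "\<dots> = weight_lhs (flmm_weight \<beta>) y n"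
    unfolding shift weight_lhs_finite[OF y] sum_distrib_left sum_subtractf[symmetric]
    by (intro sum.cong) (simp_all add: flmm_weight_def left_diff_distrib mult.assoc)
  finally show "flmm_lhs \<beta> y n = weight_lhs (flmm_weight \<beta>) y n" .
qed

text \<open>A unit impulse isolates a single weight in each equation, so the left-hand side alone
  determines every weight.\<close>

lemma has_weights_unique:
  assumes "has_weights L v" and "has_weights L w"
  shows "v = w"
proof
  fix k
  \<comment> \<open>The impulse sits at index 1 rather than 0 because the equations start at \<open>n = 1\<close>.\<close>
  define y :: "int \<Rightarrow> real" where "y j = (if j = 1 then 1 else 0)" for j
  have y: "zero_history y"
    by (simp add: zero_history_def y_def)
  have "weight_lhs u y (Suc k) = u k" for u
  proof -
    have "weight_lhs u y (Suc k) = (\<Sum>i\<le>Suc k. if i = k then u i else 0)"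
      unfolding weight_lhs_finite[OF y] by (intro sum.cong) (auto simp: y_def)
    then show ?thesis by simp
  qed
  moreover have "weight_lhs v y (Suc k) = weight_lhs w y (Suc k)"
    using assms y unfolding has_weights_def by (metis le_add1 plus_1_eq_Suc)
  ultimately show "v k = w k" by simp
qed

lemma weights_flmm: "weights (flmm_lhs \<beta>) = flmm_weight \<beta>"
  unfolding weights_def
  using has_weights_flmm_weight has_weights_unique by blast

text \<open>Delaying the coefficients by one index multiplies the sum by \<open>z\<close>, which
  produces the factor \<open>p(z)\<close>. With the limit \<open>s\<close> abstract, the real and
  complex cases share one argument.\<close>

lemma flmm_weight_sums:
  fixes z :: "'a::{banach,real_normed_field}"
  assumes "(\<lambda>k. of_real (grunwald \<beta> k) * z ^ k) sums s"
  shows "(\<lambda>k. of_real (flmm_weight \<beta> k) * z ^ k) sums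
    (s * ((1 + of_real \<beta> / 2) - of_real \<beta> / 2 * z))"
proof -
  let ?g = "\<lambda>k. case k of 0 \<Rightarrow> 0 | Suc j \<Rightarrow> grunwald \<beta> j"
  have "(\<lambda>k. of_real (?g (Suc k)) * z ^ Suc k) sums (z * s)"
    using sums_mult[OF assms, of z] by (simp add: mult_ac)
  \<comment> \<open>The term at index 0 vanishes, so prepending it leaves the sum unchanged.\<close>
  then have shift: "(\<lambda>k. of_real (?g k) * z ^ k) sums (z * s)"
    by (subst (asm) sums_Suc_iff) simp
  have "(\<lambda>k. (1 + of_real \<beta> / 2) * (of_real (grunwald \<beta> k) * z ^ k)
      - of_real \<beta> / 2 * (of_real (?g k) * z ^ k)) sums
      ((1 + of_real \<beta> / 2) * s - of_real \<beta> / 2 * (z * s))"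
    by (intro sums_diff sums_mult assms shift)
  then show ?thesis
    by (simp add: flmm_weight_def algebra_simps)
qed

lemma generating_function_flmm:
  fixes z :: "'a::{banach,real_normed_field}"
  assumes "(\<lambda>k. of_real (grunwald \<beta> k) * z ^ k) sums s"
  shows "generating_function (flmm_lhs \<beta>) z = s * ((1 + of_real \<beta> / 2) - of_real \<beta> / 2 * z)"
  using flmm_weight_sums[OF assms]
  by (simp add: generating_function_def weights_flmm sums_iff)

text \<open>The consistency estimate for the closed form, an elementary expression whose expansion
  at \<open>0\<close> can be computed with \<open>\<beta>\<close> symbolic.\<close>

lemma flmm_symbol_asymp:
  fixes \<beta> :: real
  shows "(\<lambda>x. 1 / x powr \<beta> *
      ((1 - exp (- x)) powr \<beta> * ((1 + \<beta> / 2) - \<beta> / 2 * exp (- x))) - 1)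
    \<in> O[at_right 0](\<lambda>x. x ^ 2)"
  by real_asymp

theorem theorem4:
  fixes \<beta> :: real
  assumes "0 < \<beta>" and "\<beta> \<le> 1"
  shows "(\<exists>!w. has_weights (flmm_lhs \<beta>) w) \<and>
    (\<forall>h>0. \<forall>f y. zero_history y \<longrightarrow>
       (solves_method (flmm_lhs \<beta>) \<beta> h f y \<longleftrightarrow>
        solves_method (weight_lhs (weights (flmm_lhs \<beta>))) \<beta> h f y)) \<and>
    (\<forall>\<xi>::complex. norm \<xi> < 1 \<longrightarrow>
       summable (\<lambda>k. of_real (weights (flmm_lhs \<beta>) k) * \<xi> ^ k) \<and>
       generating_function (flmm_lhs \<beta>) \<xi> =
         (1 - \<xi>) powr of_real \<beta> * ((1 + of_real \<beta> / 2) - of_real \<beta> / 2 * \<xi>)) \<and>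
    (\<lambda>x::real. 1 / x powr \<beta> * generating_function (flmm_lhs \<beta>) (exp (- x)) - 1)
      \<in> O[at_right 0](\<lambda>x. x ^ 2)"
proof (intro conjI allI impI)
  show "\<exists>!w. has_weights (flmm_lhs \<beta>) w"
    using has_weights_flmm_weight has_weights_unique by blast
next
  fix h f y
  assume "zero_history y"
  then show "solves_method (flmm_lhs \<beta>) \<beta> h f y \<longleftrightarrow>
      solves_method (weight_lhs (weights (flmm_lhs \<beta>))) \<beta> h f y"
    using has_weights_flmm_weight[of \<beta>]
    by (simp add: solves_method_def weights_flmm has_weights_def)
next
  fix \<xi> :: complex
  assume "norm \<xi> < 1"
  note sums = grunwald_sums_complex[OF this, of \<beta>]
  show "summable (\<lambda>k. of_real (weights (flmm_lhs \<beta>) k) * \<xi> ^ k)"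
    using flmm_weight_sums[OF sums] by (simp add: weights_flmm sums_iff)
  show "generating_function (flmm_lhs \<beta>) \<xi> =
      (1 - \<xi>) powr of_real \<beta> * ((1 + of_real \<beta> / 2) - of_real \<beta> / 2 * \<xi>)"
    by (rule generating_function_flmm[OF sums])
next
  \<comment> \<open>For \<open>x > 0\<close> the point \<open>exp (- x)\<close> lies inside the unit
    disc, where the series converges. The one-sided filter sees only such \<open>x\<close>, so the
    closed form may replace the series in the estimate.\<close>
  have "generating_function (flmm_lhs \<beta>) (exp (- x)) =
      (1 - exp (- x)) powr \<beta> * ((1 + \<beta> / 2) - \<beta> / 2 * exp (- x))" if "x > 0" for x :: real
    using generating_function_flmm[of \<beta> "exp (- x)"] grunwald_sums_real[of "exp (- x)" \<beta>] that
    by simp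
  then have "\<forall>\<^sub>F x::real in at_right 0.
      1 / x powr \<beta> * generating_function (flmm_lhs \<beta>) (exp (- x)) - 1 =
      1 / x powr \<beta> * ((1 - exp (- x)) powr \<beta> * ((1 + \<beta> / 2) - \<beta> / 2 * exp (- x))) - 1"
    by (intro eventually_at_right_less[THEN eventually_mono]) simp
  then show "(\<lambda>x::real. 1 / x powr \<beta> * generating_function (flmm_lhs \<beta>) (exp (- x)) - 1)
      \<in> O[at_right 0](\<lambda>x. x ^ 2)"
    using flmm_symbol_asymp by (subst landau_o.big.in_cong)
qed

end
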